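(* There exist universal constants $c_1,c_2,\dots,c_9>0$ such that the following holds. Let $\mu\in\mathbb{R}$, $0<\epsilon\le 1$ and $C>0$ be parameters, and let $\ell_{\mathrm{BC}}$ and $J$ be the square loss and the cliff reward defined in the context (in dimension $d=1$). Let $\eta,\gamma\in(0,1]$, let $T\ge 1$ be an integer, and let $\theta^{(t)}$ and $\tilde\theta_\gamma^{(t)}$ be the SGD iterates and their EMA defined in the context, with noise variance $\sigma^2=1$ and deterministic initial point satisfying $b:=|\theta^{(0)}-\mu|\le 1$. Suppose that $$\eta\ \ge\ c_1\epsilon^2\ \ge\ c_2\epsilon^2\ \ge\ \gamma,\qquad (1-\gamma)^{2T}\le\gamma .$$ Then, with $\theta^\star:=\mu$: (a) $J(\theta^\star)-\mathbb{E}[J(\theta^{(T)})]\ge \frac{C}{2}$, yet $J(\theta^\star)-\mathbb{E}[J(\tilde\theta_\gamma^{(T)})]\le c_3\left(\gamma+C e^{-c_4\epsilon^2/\gamma}\right)$. (b) $c_5\,\eta\le\mathbb{E}[\ell_{\mathrm{BC}}(\theta^{(T)})]\le c_6\,\eta$ and $c_5\,\gamma\le\mathbb{E}[\ell_{\mathrm{BC}}(\tilde\theta_\gamma^{(T)})]\le c_6\,\gamma$. (c) If moreover $\epsilon^2\ge c_7\,\gamma\log(C/\gamma)$, then $J(\theta^\star)-\mathbb{E}[J(\theta^{(T)})]\ge\frac{C}{2}$, yet $J(\theta^\star)-\mathbb{E}[J(\tilde\theta_\gamma^{(T)})]\le c_8\,\gamma$. (d) Even though $J(\theta^\star)-\mathbb{E}[J(\theta^{(T)})]\ge\frac{C}{2}$,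 we have $$\mathbb{P}\left[J(\theta^\star)-J(\theta^{(T)})\le\gamma\right]\ \ge\ c_9\,\frac{\gamma}{\eta}.$$
   Context: Square ("behavior cloning") loss: $\ell_{\mathrm{BC}}(\theta)=\frac12|\theta-\mu|^2$ for $\theta\in\mathbb{R}$. Cliff reward: $J(\theta)=-|\theta-\mu|^2$ if $|\theta-\mu|\le\epsilon$, and $J(\theta)=-C$ otherwise. It is maximized at $\theta^\star=\mu$, with $J(\theta^\star)=0$. ($C$ is thought of as much larger than $\epsilon^2$.) SGD with constant step size $\eta$: let $w^{(0)},w^{(1)},\dots$ be i.i.d. $\mathcal{N}(0,\sigma^2)$ and $y^{(t)}=\mu+w^{(t)}$. Starting from a deterministic $\theta^{(0)}\in\mathbb{R}$, set $\theta^{(t+1)}=\theta^{(t)}-\eta\,(\theta^{(t)}-y^{(t)})$ for $t\ge 0$. Exponential moving average (EMA) with constant parameter $\gamma$: $\tilde\theta_\gamma^{(0)}=\theta^{(0)}$ and $\tilde\theta_\gamma^{(t)}=\gamma\,\theta^{(t)}+(1-\gamma)\,\tilde\theta_\gamma^{(t-1)}$ for $t\ge1$. Expectations and probabilities are over the noise. "Universal" means independent of all parameters $\mu,\epsilon,C,\eta,\gamma,T,\theta^{(0)}$. *)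

theory Defs
  imports "HOL-Probability.Probability"
begin

definition bc_loss :: "real \<Rightarrow> real \<Rightarrow> real" where
  "bc_loss \<mu> \<theta> = 1 / 2 * \<bar>\<theta> - \<mu>\<bar>\<^sup>2"

definition cliff_reward :: "real \<Rightarrow> real \<Rightarrow> real \<Rightarrow> real \<Rightarrow> real" where
  "cliff_reward \<mu> \<epsilon> C \<theta> = (if \<bar>\<theta> - \<mu>\<bar> \<le> \<epsilon> then - \<bar>\<theta> - \<mu>\<bar>\<^sup>2 else - C)"

text \<open>The second parameter of \<^const>\<open>normal_density\<close> is the standard deviation,
  so \<open>\<sigma>\<^sup>2\<close> is the variance of each noise term.\<close>

definition iid_gaussian_noise :: "'a measure \<Rightarrow> real \<Rightarrow> (nat \<Rightarrow> 'a \<Rightarrow> real) \<Rightarrow> bool" where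
  "iid_gaussian_noise M \<sigma> w \<longleftrightarrow>
     prob_space M \<and>
     prob_space.indep_vars M (\<lambda>_. borel) w UNIV \<and>
     (\<forall>t. distributed M lborel (w t) (normal_density 0 \<sigma>))"

text \<open>Both recursions are defined along a single realisation: \<open>y t\<close> is the observed sample at
  step \<open>t\<close>, and \<open>x t\<close> is the sequence being averaged.\<close>

primrec sgd :: "real \<Rightarrow> real \<Rightarrow> (nat \<Rightarrow> real) \<Rightarrow> nat \<Rightarrow> real" where
  "sgd \<eta> \<theta>0 y 0 = \<theta>0"
| "sgd \<eta> \<theta>0 y (Suc t) = sgd \<eta> \<theta>0 y t - \<eta> * (sgd \<eta> \<theta>0 y t - y t)"

primrec ema :: "real \<Rightarrow> (nat \<Rightarrow> real) \<Rightarrow> nat \<Rightarrow> real" where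
  "ema \<gamma> x 0 = x 0"
| "ema \<gamma> x (Suc t) = \<gamma> * x (Suc t) + (1 - \<gamma>) * ema \<gamma> x t"

end

(*
  Around the optimum both sequences are affine in the noise, hence Gaussian.  The SGD iterate has
  variance of order \<eta>, so with \<eta> much larger than \<epsilon>^2 it leaves the \<epsilon>-ball with
  probability at least 1/2; the EMA weights of the noise are \<gamma> \<eta> / (\<eta> - \<gamma>) times
  the difference of the geometric weights (1 - \<gamma>)^k and (1 - \<eta>)^k, so the EMA has variance of
  order \<gamma>, and with \<gamma> much smaller than \<epsilon>^2 it leaves the ball only with probability
  exp (- \<epsilon>^2 / (64 \<gamma>)), up to a factor.  The separation of \<eta> from \<gamma> also
  keeps the bias of the EMA of order (1 - \<gamma>)^T, without the factor T that occurs for \<eta> = \<gamma>.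
*)

theory Submission
  imports Defs
begin

section \<open>Closed forms of the two recursions around the optimum\<close>

lemma sgd_closed_form:
  "sgd \<eta> \<theta>0 (\<lambda>s. \<mu> + u s) t - \<mu> =
    (1 - \<eta>) ^ t * (\<theta>0 - \<mu>) + (\<Sum>s<t. \<eta> * (1 - \<eta>) ^ (t - Suc s) * u s)"
proof (induction t)
  case (Suc t)
  \<comment> \<open>Each older sample has aged by one step, which costs a factor
    \<open>1 - \<eta>\<close>; the newest one, \<open>u t\<close>, enters with exponent 0.\<close>
  have "(\<Sum>s<Suc t. \<eta> * (1 - \<eta>) ^ (Suc t - Suc s) * u s) =
      (1 - \<eta>) * (\<Sum>s<t. \<eta> * (1 - \<eta>) ^ (t - Suc s) * u s) + \<eta> * u t"
    by (auto simp: sum_distrib_left Suc_diff_Suc[symmetric] intro!: sum.cong)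
  moreover have "sgd \<eta> \<theta>0 (\<lambda>s. \<mu> + u s) (Suc t) - \<mu> =
      (1 - \<eta>) * (sgd \<eta> \<theta>0 (\<lambda>s. \<mu> + u s) t - \<mu>) + \<eta> * u t"
    by (simp add: algebra_simps)
  ultimately show ?case
    unfolding Suc.IH by (simp add: algebra_simps)
qed simp

text \<open>Averaging convolves two geometric sequences, with ratios \<open>1 - \<gamma>\<close> and
  \<open>1 - \<eta>\<close>; for distinct ratios, partial fractions turn the convolution into a
  difference of powers. The coefficient of the initial error reflects that the average starts at
  \<open>x 0\<close> itself, with full weight instead of weight \<open>\<gamma>\<close>.\<close>

lemma ema_sgd_closed_form:
  assumes "\<eta> \<noteq> \<gamma>"
  shows "ema \<gamma> (sgd \<eta> \<theta>0 (\<lambda>s. \<mu> + u s)) t - \<mu> =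
    (\<eta> * (1 - \<gamma>) ^ Suc t - \<gamma> * (1 - \<eta>) ^ Suc t) / (\<eta> - \<gamma>) * (\<theta>0 - \<mu>) +
    (\<Sum>s<t. \<gamma> * \<eta> * ((1 - \<gamma>) ^ Suc (t - Suc s) - (1 - \<eta>) ^ Suc (t - Suc s)) / (\<eta> - \<gamma>) * u s)"
proof (induction t)
  case 0
  have "\<eta> * (1 - \<gamma>) - \<gamma> * (1 - \<eta>) = \<eta> - \<gamma>"
    by (simp add: algebra_simps)
  then show ?case
    using assms by simp
next
  case (Suc t)
  let ?d = "\<eta> - \<gamma>" and ?b = "\<theta>0 - \<mu>"
  let ?c = "\<lambda>k. \<gamma> * \<eta> * ((1 - \<gamma>) ^ k - (1 - \<eta>) ^ k) / ?d"
  have d: "?d \<noteq> 0"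
    using assms by simp
  \<comment> \<open>One averaging step: \<open>\<gamma>\<close> times the SGD weight with exponent
    \<open>k\<close>, plus the previous averaged weight shrunk by
    \<open>1 - \<gamma>\<close>.\<close>
  have c: "?c (Suc k) = \<gamma> * (\<eta> * (1 - \<eta>) ^ k) + (1 - \<gamma>) * ?c k" for k
    using d by (simp add: field_simps)
  have m: "(\<eta> * (1 - \<gamma>) ^ Suc (Suc t) - \<gamma> * (1 - \<eta>) ^ Suc (Suc t)) / ?d =
      \<gamma> * (1 - \<eta>) ^ Suc t + (1 - \<gamma>) * ((\<eta> * (1 - \<gamma>) ^ Suc t - \<gamma> * (1 - \<eta>) ^ Suc t) / ?d)"
    using d by (simp add: field_simps)
  have s: "(\<Sum>s<Suc t. ?c (Suc (Suc t - Suc s)) * u s) =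
      \<gamma> * (\<Sum>s<Suc t. \<eta> * (1 - \<eta>) ^ (Suc t - Suc s) * u s) +
      (1 - \<gamma>) * (\<Sum>s<t. ?c (Suc (t - Suc s)) * u s)"
  proof -
    have "(\<Sum>s<Suc t. ?c (Suc (Suc t - Suc s)) * u s) =
        \<gamma> * (\<Sum>s<Suc t. \<eta> * (1 - \<eta>) ^ (Suc t - Suc s) * u s) +
        (1 - \<gamma>) * (\<Sum>s<Suc t. ?c (Suc t - Suc s) * u s)"
      unfolding c by (simp only: sum_distrib_left sum.distrib[symmetric] algebra_simps)
    \<comment> \<open>The summand for \<open>s = t\<close> vanishes because \<open>?c 0 = 0\<close>:
      the newest noise has not reached the previous average.\<close>
    also have "(\<Sum>s<Suc t. ?c (Suc t - Suc s) * u s) = (\<Sum>s<t. ?c (Suc (t - Suc s)) * u s)"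
      by (simp del: power_Suc add: Suc_diff_Suc)
    finally show ?thesis .
  qed
  have "ema \<gamma> (sgd \<eta> \<theta>0 (\<lambda>s. \<mu> + u s)) (Suc t) - \<mu> =
      \<gamma> * (sgd \<eta> \<theta>0 (\<lambda>s. \<mu> + u s) (Suc t) - \<mu>) +
      (1 - \<gamma>) * (ema \<gamma> (sgd \<eta> \<theta>0 (\<lambda>s. \<mu> + u s)) t - \<mu>)"
    by (simp del: sgd.simps add: algebra_simps)
  then show ?case
    unfolding Suc.IH sgd_closed_form s m by (simp only: algebra_simps)
qed

section \<open>Normal laws: linear combinations, second moment, small balls and tails\<close>

text \<open>By the closed forms, each iterate at a fixed time is such a combination plus a constant.
  Positivity of the sum of squares excludes the point mass at \<open>m\<close>, which has no
  density.\<close>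

lemma iid_gaussian_noise_combination:
  assumes w: "iid_gaussian_noise M 1 w" and A: "finite A" and pos: "(\<Sum>s\<in>A. (a s)\<^sup>2) > 0"
  shows "distributed M lborel (\<lambda>\<omega>. m + (\<Sum>s\<in>A. a s * w s \<omega>))
    (normal_density m (sqrt (\<Sum>s\<in>A. (a s)\<^sup>2)))"
proof -
  interpret prob_space M
    using w by (simp add: iid_gaussian_noise_def)
  \<comment> \<open>Vanishing weights give degenerate, non-normal summands.\<close>
  define B where "B = {s\<in>A. a s \<noteq> 0}"
  have B: "finite B" and BA: "B \<subseteq> A"
    using A by (auto simp: B_def)
  have eq: "(\<Sum>s\<in>A. (a s)\<^sup>2) = (\<Sum>s\<in>B. (a s)\<^sup>2)"
    "(\<Sum>s\<in>A. a s * w s \<omega>) = (\<Sum>s\<in>B. a s * w s \<omega>)" for \<omega>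
    by (auto intro!: sum.mono_neutral_right A simp: B_def)
  have B_ne: "B \<noteq> {}"
    using pos eq by auto
  have "indep_vars (\<lambda>_. borel) w B"
    using w indep_vars_subset[of _ w UNIV B] by (auto simp: iid_gaussian_noise_def)
  then have ind: "indep_vars (\<lambda>_. borel) (\<lambda>s \<omega>. a s * w s \<omega>) B"
    by (rule indep_vars_compose2[where Y = "\<lambda>s x. a s * x"]) auto
  have nrm: "distributed M lborel (\<lambda>\<omega>. a s * w s \<omega>) (normal_density 0 \<bar>a s\<bar>)" if "s \<in> B" for s
    using normal_density_affine[of "w s" 0 1 "a s" 0] w that
    by (auto simp: iid_gaussian_noise_def B_def)
  have "distributed M lborel (\<lambda>\<omega>. \<Sum>s\<in>B. a s * w s \<omega>)
      (normal_density (\<Sum>s\<in>B. 0) (sqrt (\<Sum>s\<in>B. \<bar>a s\<bar>\<^sup>2)))"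
    by (rule sum_indep_normal[OF B B_ne ind _ nrm]) (auto simp: B_def)
  from normal_density_affine[OF this, of 1 m] pos show ?thesis
    unfolding eq by simp
qed

context prob_space
begin

lemma normal_second_moment:
  assumes D: "distributed M lborel X (normal_density m \<sigma>)" and \<sigma>: "0 < \<sigma>"
  shows "integrable M (\<lambda>\<omega>. (X \<omega>)\<^sup>2)" and "expectation (\<lambda>\<omega>. (X \<omega>)\<^sup>2) = m\<^sup>2 + \<sigma>\<^sup>2"
proof -
  note \<sigma>[arith]
  \<comment> \<open>The even moments at hand are centred at \<open>m\<close>, so \<open>x^2\<close>
    is split as \<open>(x - m)^2 + 2 * m * x - m^2\<close>.\<close>
  have eq: "normal_density m \<sigma> x * x\<^sup>2 =
      normal_density m \<sigma> x * (x - m)^2 + 2 * m * (normal_density m \<sigma> x * x) - m\<^sup>2 * normal_density m \<sigma> x" for x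
    by (simp add: algebra_simps power2_eq_square)
  have i1: "integrable lborel (\<lambda>x. normal_density m \<sigma> x * (x - m)^2)"
    by (rule integrable_normal_moment[OF \<sigma>])
  have i2: "integrable lborel (\<lambda>x. normal_density m \<sigma> x * x)"
    by (rule integrable_normal_moment_nz_1[OF \<sigma>])
  have i3: "integrable lborel (normal_density m \<sigma>)"
    by (rule integrable_normal_density[OF \<sigma>])
  have "integrable lborel (\<lambda>x. normal_density m \<sigma> x * x\<^sup>2)"
    unfolding eq using i1 i2 i3 by auto
  then show "integrable M (\<lambda>\<omega>. (X \<omega>)\<^sup>2)"
    using distributed_integrable[OF D, of "\<lambda>x. x\<^sup>2"] by simp
  have "(\<integral>x. normal_density m \<sigma> x * x\<^sup>2 \<partial>lborel) = \<sigma>\<^sup>2 + 2 * m * m - m\<^sup>2"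
    unfolding eq using i1 i2 i3 integral_normal_moment_even[OF \<sigma>, of m 1]
    by (simp add: integral_normal_moment_nz_1 eval_nat_numeral)
  then show "expectation (\<lambda>\<omega>. (X \<omega>)\<^sup>2) = m\<^sup>2 + \<sigma>\<^sup>2"
    using distributed_integral[OF D, of "\<lambda>x. x\<^sup>2"] by (simp add: power2_eq_square)
qed

text \<open>Reduces the probability estimates below to pointwise comparisons of densities; the
  second part supplies the integrability that monotonicity of the integral asks for.\<close>

lemma distributed_prob:
  assumes D: "distributed M lborel X (\<lambda>x. ennreal (f x))" and "\<And>x. 0 \<le> f x"
    and P[measurable]: "Measurable.pred borel P"
  shows "\<P>(\<omega> in M. P (X \<omega>)) = (\<integral>x. f x * indicator {x. P x} x \<partial>lborel)"
    and "integrable lborel (\<lambda>x. f x * indicator {x. P x} x)"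
proof -
  have X[measurable]: "X \<in> borel_measurable M"
    using distributed_measurable[OF D] by simp
  have eq: "(\<lambda>\<omega>. indicator {x. P x} (X \<omega>) :: real) = indicator {\<omega>. P (X \<omega>)}"
    by (auto simp: fun_eq_iff split: split_indicator)
  have "(\<integral>\<omega>. indicator {\<omega>. P (X \<omega>)} \<omega> \<partial>M) = measure M ({\<omega>. P (X \<omega>)} \<inter> space M)"
    by simp
  also have "{\<omega>. P (X \<omega>)} \<inter> space M = {\<omega>\<in>space M. P (X \<omega>)}"
    by auto
  finally show "\<P>(\<omega> in M. P (X \<omega>)) = (\<integral>x. f x * indicator {x. P x} x \<partial>lborel)"
    using distributed_integral[OF D, of "indicator {x. P x}"] assms by (simp add: eq)
  have "integrable M (\<lambda>\<omega>. indicator {x. P x} (X \<omega>) :: real)"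
    by (rule integrable_const_bound[of _ 1]) (auto split: split_indicator)
  then show "integrable lborel (\<lambda>x. f x * indicator {x. P x} x)"
    using distributed_integrable[OF D, of "indicator {x. P x}"] assms by simp
qed

text \<open>The density is at most its peak value, so the bound is uniform in the mean.\<close>

lemma normal_small_ball_upper:
  assumes D: "distributed M lborel X (normal_density m \<sigma>)" and \<sigma>: "0 < \<sigma>" and r: "0 \<le> r"
  shows "\<P>(\<omega> in M. \<bar>X \<omega>\<bar> \<le> r) \<le> 2 * r / sqrt (2 * pi * \<sigma>\<^sup>2)"
proof -
  have set: "{x. \<bar>x\<bar> \<le> r} = {-r..r}"
    by auto
  have "\<P>(\<omega> in M. \<bar>X \<omega>\<bar> \<le> r) = (\<integral>x. normal_density m \<sigma> x * indicator {-r..r} x \<partial>lborel)"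
    using distributed_prob(1)[OF D, of "\<lambda>x. \<bar>x\<bar> \<le> r"] by (simp add: set)
  also have "\<dots> \<le> (\<integral>x. 1 / sqrt (2 * pi * \<sigma>\<^sup>2) * indicator {-r..r} x \<partial>lborel)"
  proof (rule integral_mono)
    show "integrable lborel (\<lambda>x. normal_density m \<sigma> x * indicator {-r..r} x)"
      using distributed_prob(2)[OF D, of "\<lambda>x. \<bar>x\<bar> \<le> r"] by (simp add: set)
    show "normal_density m \<sigma> x * indicator {-r..r} x \<le> 1 / sqrt (2 * pi * \<sigma>\<^sup>2) * indicator {-r..r} x" for x
      by (intro mult_right_mono) (auto simp: normal_density_def divide_right_mono)
  qed (intro integrable_mult_right integrable_real_indicator, auto simp: emeasure_lborel_Icc_eq)
  also have "\<dots> = 2 * r / sqrt (2 * pi * \<sigma>\<^sup>2)"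
    using r by simp
  finally show ?thesis .
qed

text \<open>On the ball the distance to the mean is at most \<open>\<bar>m\<bar> + r\<close>, which
  bounds the density below by a constant.\<close>

lemma normal_small_ball_lower:
  assumes D: "distributed M lborel X (normal_density m \<sigma>)" and \<sigma>: "0 < \<sigma>" and r: "0 \<le> r"
  shows "2 * r / sqrt (2 * pi * \<sigma>\<^sup>2) * exp (- (\<bar>m\<bar> + r)\<^sup>2 / (2 * \<sigma>\<^sup>2)) \<le> \<P>(\<omega> in M. \<bar>X \<omega>\<bar> \<le> r)"
proof -
  have set: "{x. \<bar>x\<bar> \<le> r} = {-r..r}"
    by auto
  let ?c = "1 / sqrt (2 * pi * \<sigma>\<^sup>2) * exp (- (\<bar>m\<bar> + r)\<^sup>2 / (2 * \<sigma>\<^sup>2))"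
  have "2 * r / sqrt (2 * pi * \<sigma>\<^sup>2) * exp (- (\<bar>m\<bar> + r)\<^sup>2 / (2 * \<sigma>\<^sup>2)) =
      (\<integral>x. ?c * indicator {-r..r} x \<partial>lborel)"
    using r by simp
  also have "\<dots> \<le> (\<integral>x. normal_density m \<sigma> x * indicator {-r..r} x \<partial>lborel)"
  proof (rule integral_mono)
    show "integrable lborel (\<lambda>x. normal_density m \<sigma> x * indicator {-r..r} x)"
      using distributed_prob(2)[OF D, of "\<lambda>x. \<bar>x\<bar> \<le> r"] by (simp add: set)
    show "?c * indicator {-r..r} x \<le> normal_density m \<sigma> x * indicator {-r..r} x" for x
    proof (cases "x \<in> {-r..r}")
      case True
      then have "(x - m)\<^sup>2 \<le> (\<bar>m\<bar> + r)\<^sup>2"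
        by (intro abs_le_square_iff[THEN iffD1]) auto
      then have "- (\<bar>m\<bar> + r)\<^sup>2 / (2 * \<sigma>\<^sup>2) \<le> - (x - m)\<^sup>2 / (2 * \<sigma>\<^sup>2)"
        by (intro divide_right_mono) auto
      then have "?c \<le> normal_density m \<sigma> x"
        unfolding normal_density_def by (intro mult_left_mono) auto
      then show ?thesis
        using True by simp
    qed simp
  qed (intro integrable_mult_right integrable_real_indicator, auto simp: emeasure_lborel_Icc_eq)
  also have "\<dots> = \<P>(\<omega> in M. \<bar>X \<omega>\<bar> \<le> r)"
    using distributed_prob(1)[OF D, of "\<lambda>x. \<bar>x\<bar> \<le> r"] by (simp add: set)
  finally show ?thesis .
qed

text \<open>The mean uses up at most half of the radius, so an excursion beyond \<open>r\<close> is
  at distance at least \<open>r / 2\<close> from \<open>m\<close>. Comparing with a wider normal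
  density of total mass 1 then suffices, at the price of 16 in the exponent.\<close>

lemma normal_tail:
  assumes D: "distributed M lborel X (normal_density m \<sigma>)" and \<sigma>: "0 < \<sigma>"
    and r: "2 * \<bar>m\<bar> \<le> r"
  shows "\<P>(\<omega> in M. r < \<bar>X \<omega>\<bar>) \<le> 2 * exp (- r\<^sup>2 / (16 * \<sigma>\<^sup>2))"
proof -
  \<comment> \<open>The factor \<open>sqrt 2\<close> is the quotient of the normalising constants
    for the standard deviations \<open>\<sigma>\<close> and
    \<open>sqrt 2 * \<sigma>\<close>.\<close>
  let ?c = "sqrt 2 * exp (- r\<^sup>2 / (16 * \<sigma>\<^sup>2))"
  have s2: "0 < sqrt 2 * \<sigma>"
    using \<sigma> by simp
  have "\<P>(\<omega> in M. r < \<bar>X \<omega>\<bar>) = (\<integral>x. normal_density m \<sigma> x * indicator {x. r < \<bar>x\<bar>} x \<partial>lborel)"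
    using distributed_prob(1)[OF D, of "\<lambda>x. r < \<bar>x\<bar>"] by simp
  also have "\<dots> \<le> (\<integral>x. ?c * normal_density m (sqrt 2 * \<sigma>) x \<partial>lborel)"
  proof (rule integral_mono)
    show "integrable lborel (\<lambda>x. normal_density m \<sigma> x * indicator {x. r < \<bar>x\<bar>} x)"
      using distributed_prob(2)[OF D, of "\<lambda>x. r < \<bar>x\<bar>"] by simp
    show "integrable lborel (\<lambda>x. ?c * normal_density m (sqrt 2 * \<sigma>) x)"
      using integrable_normal_density[OF s2] by simp
    show "normal_density m \<sigma> x * indicator {x. r < \<bar>x\<bar>} x \<le> ?c * normal_density m (sqrt 2 * \<sigma>) x" for x
    proof (cases "r < \<bar>x\<bar>")
      case True
      \<comment> \<open>Doubling the variance halves the exponent; the other half yields the decay.\<close>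
      have "\<bar>r / 2\<bar> \<le> \<bar>x - m\<bar>"
        using True r by linarith
      then have "(r / 2)\<^sup>2 \<le> (x - m)\<^sup>2"
        by (rule abs_le_square_iff[THEN iffD1])
      then have "- (x - m)\<^sup>2 / (4 * \<sigma>\<^sup>2) \<le> - (r / 2)\<^sup>2 / (4 * \<sigma>\<^sup>2)"
        by (intro divide_right_mono) auto
      also have "\<dots> = - r\<^sup>2 / (16 * \<sigma>\<^sup>2)"
        by (simp add: power_divide)
      finally have "exp (- (x - m)\<^sup>2 / (4 * \<sigma>\<^sup>2)) \<le> exp (- r\<^sup>2 / (16 * \<sigma>\<^sup>2))"
        by simp
      moreover have "exp (- (x - m)\<^sup>2 / (2 * \<sigma>\<^sup>2)) =
          exp (- (x - m)\<^sup>2 / (4 * \<sigma>\<^sup>2)) * exp (- (x - m)\<^sup>2 / (2 * (sqrt 2 * \<sigma>)\<^sup>2))"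
        using \<sigma> by (simp add: exp_add[symmetric] power_mult_distrib field_simps)
      moreover have "1 / sqrt (2 * pi * \<sigma>\<^sup>2) = sqrt 2 * (1 / sqrt (2 * pi * (sqrt 2 * \<sigma>)\<^sup>2))"
        using \<sigma> by (simp add: power_mult_distrib real_sqrt_mult field_simps)
      ultimately have "normal_density m \<sigma> x \<le> ?c * normal_density m (sqrt 2 * \<sigma>) x"
        unfolding normal_density_def
        by (simp only: mult.assoc mult.left_commute[of _ "sqrt 2"])
          (intro mult_left_mono, auto simp: mult.left_commute intro!: divide_right_mono mult_right_mono)
      then show ?thesis
        using True by simp
    qed simp
  qed
  also have "\<dots> = ?c"
    using integral_normal_density[OF s2] by simp
  also have "\<dots> \<le> 2 * exp (- r\<^sup>2 / (16 * \<sigma>\<^sup>2))"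
    by (intro mult_right_mono) (auto intro: real_le_lsqrt)
  finally show ?thesis .
qed

section \<open>Bounds on the expected cliff reward\<close>

lemma cliff_reward_integrable:
  assumes [measurable]: "X \<in> borel_measurable M"
  shows "integrable M (\<lambda>\<omega>. cliff_reward \<mu> \<epsilon> C (X \<omega>))"
proof (rule integrable_const_bound)
  have "\<bar>cliff_reward \<mu> \<epsilon> C x\<bar> \<le> \<epsilon>\<^sup>2 + \<bar>C\<bar>" for x
    using abs_le_square_iff[of "x - \<mu>" \<epsilon>] by (auto simp: cliff_reward_def)
  then show "AE \<omega> in M. norm (cliff_reward \<mu> \<epsilon> C (X \<omega>)) \<le> \<epsilon>\<^sup>2 + \<bar>C\<bar>"
    by simp
qed (simp add: cliff_reward_def[abs_def])

text \<open>Inside the ball the reward is at most 0, so only the penalty is counted.\<close>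

lemma cliff_reward_expectation_le:
  assumes [measurable]: "X \<in> borel_measurable M"
  shows "expectation (\<lambda>\<omega>. cliff_reward \<mu> \<epsilon> C (X \<omega>)) \<le> - C * \<P>(\<omega> in M. \<epsilon> < \<bar>X \<omega> - \<mu>\<bar>)"
proof -
  let ?A = "{\<omega>\<in>space M. \<epsilon> < \<bar>X \<omega> - \<mu>\<bar>}"
  have "expectation (\<lambda>\<omega>. cliff_reward \<mu> \<epsilon> C (X \<omega>)) \<le> expectation (\<lambda>\<omega>. - C * indicator ?A \<omega>)"
    by (intro integral_mono cliff_reward_integrable)
      (auto simp: cliff_reward_def less_top[symmetric] split: split_indicator intro!: integrable_real_indicator)
  then show ?thesis
    by simp
qed

text \<open>The square is charged outside the ball as well; this only lowers the bound and replaces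
  a truncated moment by the full second moment.\<close>

lemma cliff_reward_expectation_ge:
  assumes [measurable]: "X \<in> borel_measurable M"
    and int: "integrable M (\<lambda>\<omega>. (X \<omega> - \<mu>)\<^sup>2)"
  shows "- expectation (\<lambda>\<omega>. (X \<omega> - \<mu>)\<^sup>2) - C * \<P>(\<omega> in M. \<epsilon> < \<bar>X \<omega> - \<mu>\<bar>)
    \<le> expectation (\<lambda>\<omega>. cliff_reward \<mu> \<epsilon> C (X \<omega>))"
proof -
  let ?A = "{\<omega>\<in>space M. \<epsilon> < \<bar>X \<omega> - \<mu>\<bar>}"
  have ind: "integrable M (\<lambda>\<omega>. C * indicator ?A \<omega>)"
    by (auto simp: less_top[symmetric] intro!: integrable_real_indicator)
  have "expectation (\<lambda>\<omega>. - (X \<omega> - \<mu>)\<^sup>2 - C * indicator ?A \<omega>)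
      \<le> expectation (\<lambda>\<omega>. cliff_reward \<mu> \<epsilon> C (X \<omega>))"
    using int ind by (intro integral_mono cliff_reward_integrable)
      (auto simp: cliff_reward_def split: split_indicator)
  then show ?thesis
    using int ind by simp
qed

end


section \<open>Gaussian laws of the SGD iterate and of its average\<close>

lemma sgd_normal:
  assumes w: "iid_gaussian_noise M 1 w" and \<eta>: "0 < \<eta>" "\<eta> \<le> 1" and T: "(1 - \<eta>) ^ (2 * T) \<le> 1 / 16"
  obtains m \<sigma> where "0 < \<sigma>"
    "distributed M lborel (\<lambda>\<omega>. sgd \<eta> \<theta>0 (\<lambda>s. \<mu> + w s \<omega>) T - \<mu>) (normal_density m \<sigma>)"
    "m\<^sup>2 = (1 - \<eta>) ^ (2 * T) * (\<theta>0 - \<mu>)\<^sup>2" "\<eta> / 4 \<le> \<sigma>\<^sup>2" "\<sigma>\<^sup>2 \<le> \<eta>"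
proof -
  let ?V = "\<Sum>s<T. (\<eta> * (1 - \<eta>) ^ (T - Suc s))\<^sup>2"
  let ?q = "(1 - \<eta>)\<^sup>2"
  have "?V = (\<Sum>k<T. (\<eta> * (1 - \<eta>) ^ k)\<^sup>2)"
    by (rule sum.nat_diff_reindex)
  also have "\<dots> = \<eta>\<^sup>2 * (\<Sum>k<T. ?q ^ k)"
    by (simp add: sum_distrib_left power_mult_distrib power_mult[symmetric] mult.commute)
  \<comment> \<open>Since \<open>1 - (1 - \<eta>)^2 = \<eta> * (2 - \<eta>)\<close>, the geometric
    sum is evaluated without division.\<close>
  finally have "(2 - \<eta>) * ?V = \<eta> * ((1 - ?q) * (\<Sum>k<T. ?q ^ k))"
    by (simp add: algebra_simps power2_eq_square)
  also have "\<dots> = \<eta> * (1 - (1 - \<eta>) ^ (2 * T))"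
    by (simp only: one_diff_power_eq[symmetric] power_mult)
  finally have V: "(2 - \<eta>) * ?V = \<eta> * (1 - (1 - \<eta>) ^ (2 * T))" .
  have V0: "0 \<le> ?V"
    by (simp add: sum_nonneg)
  \<comment> \<open>Here \<open>2 - \<eta>\<close> lies between 1 and 2, and the last factor is at
    least 15/16, of which 1/2 suffices; hence \<open>\<eta> / 4\<close> from below and
    \<open>\<eta>\<close> from above.\<close>
  have "(2 - \<eta>) * ?V \<le> 2 * ?V"
    using \<eta> V0 by (intro mult_right_mono) auto
  moreover have "\<eta> * (1 / 2) \<le> \<eta> * (1 - (1 - \<eta>) ^ (2 * T))"
    using \<eta> T by (intro mult_left_mono) auto
  ultimately have lower: "\<eta> / 4 \<le> ?V"
    using V by linarith
  have "1 * ?V \<le> (2 - \<eta>) * ?V"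
    using \<eta> V0 by (intro mult_right_mono) auto
  moreover have "\<eta> * (1 - (1 - \<eta>) ^ (2 * T)) \<le> \<eta> * 1"
    using \<eta> by (intro mult_left_mono) auto
  ultimately have upper: "?V \<le> \<eta>"
    using V by linarith
  have pos: "0 < ?V"
    using lower \<eta> by linarith
  show thesis
  proof (rule that)
    show "distributed M lborel (\<lambda>\<omega>. sgd \<eta> \<theta>0 (\<lambda>s. \<mu> + w s \<omega>) T - \<mu>)
        (normal_density ((1 - \<eta>) ^ T * (\<theta>0 - \<mu>)) (sqrt ?V))"
      unfolding sgd_closed_form by (rule iid_gaussian_noise_combination[OF w _ pos]) simp
  qed (use pos V0 lower upper in \<open>auto simp: power_mult_distrib power_mult[symmetric] mult.commute\<close>)
qed

text \<open>The variance is \<open>K^2 * S\<close> with \<open>K\<close> between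
  \<open>\<gamma>\<close> and \<open>2 * \<gamma>\<close>, hence of order \<open>\<gamma>\<close>
  once \<open>S\<close> is of order \<open>1 / \<gamma>\<close>. In \<open>S\<close> the squares of
  the slow powers of \<open>1 - \<gamma>\<close> dominate: the cross terms with the fast powers of
  \<open>1 - \<eta>\<close> sum to order \<open>1 / \<eta>\<close>, which the factor 16 between
  \<open>\<gamma>\<close> and \<open>\<eta>\<close> makes small against
  \<open>1 / \<gamma>\<close>.\<close>

lemma ema_sgd_normal:
  assumes w: "iid_gaussian_noise M 1 w" and \<gamma>: "0 < \<gamma>" "16 * \<gamma> \<le> \<eta>" and \<eta>: "\<eta> \<le> 1"
    and T: "(1 - \<gamma>) ^ (2 * T) \<le> 1 / 16"
  obtains m \<sigma> where "0 < \<sigma>"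
    "distributed M lborel (\<lambda>\<omega>. ema \<gamma> (sgd \<eta> \<theta>0 (\<lambda>s. \<mu> + w s \<omega>)) T - \<mu>) (normal_density m \<sigma>)"
    "m\<^sup>2 \<le> 4 * (1 - \<gamma>) ^ (2 * T) * (\<theta>0 - \<mu>)\<^sup>2" "\<gamma> / 4 \<le> \<sigma>\<^sup>2" "\<sigma>\<^sup>2 \<le> 4 * \<gamma>"
proof -
  define p e K where "p = 1 - \<gamma>" and "e = 1 - \<eta>" and "K = \<gamma> * \<eta> / (\<eta> - \<gamma>)"
  let ?a = "\<lambda>s. \<gamma> * \<eta> * (p ^ Suc (T - Suc s) - e ^ Suc (T - Suc s)) / (\<eta> - \<gamma>)"
  let ?V = "\<Sum>s<T. (?a s)\<^sup>2"
  let ?m = "(\<eta> * p ^ Suc T - \<gamma> * e ^ Suc T) / (\<eta> - \<gamma>) * (\<theta>0 - \<mu>)"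
  have bnds: "0 \<le> e" "e \<le> p" "0 < \<eta>" "0 < \<eta> - \<gamma>" "15 / 16 \<le> p" "p \<le> 1" "\<eta> \<le> 2 * (\<eta> - \<gamma>)"
    using \<gamma> \<eta> by (auto simp: p_def e_def)
  have K: "\<gamma> \<le> K" "K \<le> 2 * \<gamma>"
    using \<gamma> \<eta> bnds by (auto simp: K_def field_simps)
  have ep: "e ^ k \<le> p ^ k" "0 \<le> e ^ k" "0 \<le> p ^ k" for k
    using bnds by (auto intro: power_mono)

  \<comment> \<open>\<open>S\<close> is the sum of squared weights without the prefactor
    \<open>K^2\<close>; \<open>Q\<close> and \<open>R\<close> are the geometric sums governing its
    slow squares and its cross terms.\<close>
  define S Q R where "S = (\<Sum>k<T. (p ^ Suc k - e ^ Suc k)\<^sup>2)" and "Q = (\<Sum>k<T. (p\<^sup>2) ^ k)"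
    and "R = (\<Sum>k<T. (p * e) ^ k)"
  have "?V = (\<Sum>k<T. (\<gamma> * \<eta> * (p ^ Suc k - e ^ Suc k) / (\<eta> - \<gamma>))\<^sup>2)"
    by (rule sum.nat_diff_reindex)
  also have "\<dots> = (\<Sum>k<T. K\<^sup>2 * (p ^ Suc k - e ^ Suc k)\<^sup>2)"
    by (simp only: K_def power_mult_distrib power_divide times_divide_eq_left)
  finally have V: "?V = K\<^sup>2 * S"
    by (simp only: S_def sum_distrib_left)

  have QR: "0 \<le> Q" "0 \<le> R"
    using bnds by (auto simp: Q_def R_def intro!: sum_nonneg)
  have Q: "\<gamma> * (2 - \<gamma>) * Q = 1 - p ^ (2 * T)"
  proof -
    have "\<gamma> * (2 - \<gamma>) = 1 - p\<^sup>2"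
      by (simp add: p_def power2_eq_square algebra_simps)
    then show ?thesis
      by (simp only: Q_def one_diff_power_eq[symmetric] power_mult)
  qed
  \<comment> \<open>Both bounds use that \<open>2 - \<gamma>\<close> lies between 1 and 2; 15/32 is
    half of \<open>1 - 1/16\<close>.\<close>
  have "\<gamma> * 1 * Q \<le> \<gamma> * (2 - \<gamma>) * Q"
    using \<gamma> \<eta> QR by (intro mult_right_mono mult_left_mono) auto
  then have Q_upper: "\<gamma> * Q \<le> 1"
    using Q ep(3)[of "2 * T"] by linarith
  have "\<gamma> * (2 - \<gamma>) * Q \<le> \<gamma> * 2 * Q"
    using \<gamma> \<eta> QR by (intro mult_right_mono mult_left_mono) auto
  then have Q_lower: "15 / 32 \<le> \<gamma> * Q"
    using Q T by (simp add: p_def)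
  \<comment> \<open>From \<open>p * e \<le> e = 1 - \<eta>\<close>, the ratio of \<open>R\<close>
    stays \<open>\<eta>\<close> away from 1, so
    \<open>R \<le> 1 / \<eta> \<le> 1 / (16 * \<gamma>)\<close>.\<close>
  have "\<eta> * R \<le> (1 - p * e) * R"
    using \<gamma> \<eta> QR bnds mult_right_mono[of p 1 e] by (intro mult_right_mono) (auto simp: e_def)
  also have "\<dots> = 1 - (p * e) ^ T"
    by (simp add: R_def one_diff_power_eq)
  also have "\<dots> \<le> 1"
    using bnds by simp
  finally have "16 * \<gamma> * R \<le> 1"
    using mult_right_mono[OF \<gamma>(2) QR(2)] by linarith

  \<comment> \<open>Expand the square, drop the fast squares and replace one factor
    \<open>p * e\<close> of the cross term by 1.\<close>
  moreover have "p\<^sup>2 * Q - 2 * R \<le> S"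
  proof -
    have "p\<^sup>2 * (p\<^sup>2) ^ k - 2 * (p * e) ^ k \<le> (p ^ Suc k - e ^ Suc k)\<^sup>2" for k
    proof -
      have "(p ^ Suc k - e ^ Suc k)\<^sup>2 = (p ^ Suc k)\<^sup>2 - 2 * (p ^ Suc k * e ^ Suc k) + (e ^ Suc k)\<^sup>2"
        by (simp only: power2_diff algebra_simps)
      moreover have "p ^ Suc k * e ^ Suc k = (p * e) * (p * e) ^ k"
        by (simp add: power_mult_distrib)
      moreover have "(p * e) * (p * e) ^ k \<le> 1 * (p * e) ^ k"
        using bnds \<gamma> by (intro mult_right_mono mult_le_one) (auto simp: e_def)
      moreover have "(p ^ Suc k)\<^sup>2 = p\<^sup>2 * (p\<^sup>2) ^ k"
        by (simp add: power_mult_distrib power_mult[symmetric] mult.commute)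
      moreover have "0 \<le> (e ^ Suc k)\<^sup>2"
        by simp
      ultimately show ?thesis
        by linarith
    qed
    from sum_mono[where K = "{..<T}", OF this] show ?thesis
      by (simp only: S_def Q_def R_def sum_distrib_left sum_subtractf)
  qed
  then have "\<gamma> * (p\<^sup>2 * Q - 2 * R) \<le> \<gamma> * S"
    using \<gamma> by simp
  \<comment> \<open>225/256 is the square of the lower bound 15/16 on \<open>p\<close>; numerically,
    \<open>225/256 * 15/32 - 2/16\<close> exceeds 1/4.\<close>
  moreover have "225 / 256 * (\<gamma> * Q) \<le> p\<^sup>2 * (\<gamma> * Q)"
    using power_mono[OF bnds(5), of 2] \<gamma> QR by (intro mult_right_mono) (auto simp: power_divide)
  ultimately have S_lower: "1 / 4 \<le> \<gamma> * S"
    using Q_lower by (simp add: algebra_simps)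
  have "S \<le> Q"
    unfolding S_def Q_def
  proof (rule sum_mono)
    fix k
    have "(p ^ Suc k - e ^ Suc k)\<^sup>2 \<le> (p ^ k)\<^sup>2"
      using ep[of "Suc k"] mult_right_mono[OF bnds(6) ep(3)[of k]] by (intro power_mono) auto
    then show "(p ^ Suc k - e ^ Suc k)\<^sup>2 \<le> (p\<^sup>2) ^ k"
      by (simp only: power_mult[symmetric] mult.commute)
  qed
  then have S_upper: "\<gamma> * S \<le> 1"
    using Q_upper \<gamma> mult_left_mono[of S Q \<gamma>] by linarith
  have S0: "0 \<le> S"
    by (simp add: S_def sum_nonneg)

  have "\<gamma> * (1 / 4) \<le> \<gamma> * (\<gamma> * S)"
    using S_lower \<gamma> by (intro mult_left_mono) auto
  also have "\<dots> = \<gamma>\<^sup>2 * S"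
    by (simp add: power2_eq_square)
  also have "\<dots> \<le> K\<^sup>2 * S"
    using K \<gamma> S0 by (intro mult_right_mono power_mono) auto
  finally have lower: "\<gamma> / 4 \<le> ?V"
    unfolding V by simp
  have "K\<^sup>2 * S \<le> (2 * \<gamma>)\<^sup>2 * S"
    using K \<gamma> S0 by (intro mult_right_mono power_mono) auto
  also have "\<dots> = 4 * \<gamma> * (\<gamma> * S)"
    by (simp add: power2_eq_square)
  also have "\<dots> \<le> 4 * \<gamma> * 1"
    using S_upper \<gamma> by (intro mult_left_mono) auto
  finally have upper: "?V \<le> 4 * \<gamma>"
    unfolding V by simp
  have pos: "0 < ?V"
    using lower \<gamma> by linarith

  \<comment> \<open>The coefficient of the initial error lies between 0 and
    \<open>2 * p ^ T\<close>, because \<open>\<eta> / (\<eta> - \<gamma>) \<le> 2\<close>; squaring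
    gives the factor 4.\<close>
  have "\<gamma> * e ^ Suc T \<le> \<eta> * p ^ Suc T"
    using ep[of "Suc T"] \<gamma> by (intro mult_mono) auto
  moreover have "\<eta> * p ^ Suc T - \<gamma> * e ^ Suc T \<le> \<eta> * p ^ T"
    using bnds \<gamma> ep(2)[of "Suc T"] power_decreasing[of T "Suc T" p]
      mult_left_mono[of "p ^ Suc T" "p ^ T" \<eta>] mult_nonneg_nonneg[of \<gamma> "e ^ Suc T"] by linarith
  moreover have "\<eta> * p ^ T \<le> 2 * (\<eta> - \<gamma>) * p ^ T"
    using bnds ep by (intro mult_right_mono) auto
  ultimately have "0 \<le> (\<eta> * p ^ Suc T - \<gamma> * e ^ Suc T) / (\<eta> - \<gamma>)"
    "(\<eta> * p ^ Suc T - \<gamma> * e ^ Suc T) / (\<eta> - \<gamma>) \<le> 2 * p ^ T"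
    using bnds by (auto simp only: pos_divide_le_eq mult_ac intro!: divide_nonneg_pos)
  then have "((\<eta> * p ^ Suc T - \<gamma> * e ^ Suc T) / (\<eta> - \<gamma>))\<^sup>2 \<le> (2 * p ^ T)\<^sup>2"
    by (intro power_mono)
  then have "?m\<^sup>2 \<le> (2 * p ^ T)\<^sup>2 * (\<theta>0 - \<mu>)\<^sup>2"
    unfolding power_mult_distrib[of _ "\<theta>0 - \<mu>"] by (rule mult_right_mono) simp
  also have "(2 * p ^ T)\<^sup>2 = 4 * p ^ (2 * T)"
    by (simp add: power_mult_distrib power_mult[symmetric] mult.commute)
  finally have m: "?m\<^sup>2 \<le> 4 * (1 - \<gamma>) ^ (2 * T) * (\<theta>0 - \<mu>)\<^sup>2"
    by (simp only: p_def)

  have "distributed M lborel (\<lambda>\<omega>. ema \<gamma> (sgd \<eta> \<theta>0 (\<lambda>s. \<mu> + w s \<omega>)) T - \<mu>)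
      (normal_density ?m (sqrt ?V))"
    using bnds(4) iid_gaussian_noise_combination[OF w _ pos, of ?m]
    by (subst ema_sgd_closed_form) (auto simp only: p_def e_def finite_lessThan)
  then show thesis
    using that[of "sqrt ?V" ?m] pos m lower upper by auto
qed

section \<open>Loss and reward of the SGD iterate and of its average\<close>

lemma sgd_measurable [measurable]:
  assumes [measurable]: "\<And>s. w s \<in> borel_measurable M"
  shows "(\<lambda>\<omega>. sgd \<eta> \<theta>0 (\<lambda>s. \<mu> + w s \<omega>) t) \<in> borel_measurable M"
  by (induction t) simp_all

lemma ema_measurable [measurable]:
  assumes [measurable]: "\<And>s. x s \<in> borel_measurable M"
  shows "(\<lambda>\<omega>. ema \<gamma> (\<lambda>s. x s \<omega>) t) \<in> borel_measurable M"
  by (induction t) simp_all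

text \<open>From \<open>64 * \<epsilon>^2 \<le> \<eta>\<close> the standard deviation is at least
  \<open>4 * \<epsilon>\<close>, so the ball of radius \<open>\<epsilon>\<close> holds at most half
  of the mass. From \<open>\<gamma> \<le> \<epsilon>^2 / 16\<close> the ball of radius
  \<open>sqrt \<gamma>\<close> lies inside it, and there the reward falls short by at most
  \<open>\<gamma>\<close>. The burn-in condition is stated for \<open>\<gamma>\<close> but passes to
  the larger \<open>\<eta>\<close>, so the squared bias is at most \<open>\<gamma>\<close>.\<close>

lemma sgd_cliff_bounds:
  assumes w: "iid_gaussian_noise M 1 w" and \<epsilon>: "0 < \<epsilon>" and C: "0 < C" and \<eta>: "\<eta> \<in> {0<..1}"
    and \<gamma>: "0 < \<gamma>" and b: "\<bar>\<theta>0 - \<mu>\<bar> \<le> 1" and scale: "64 * \<epsilon>\<^sup>2 \<le> \<eta>" "\<gamma> \<le> \<epsilon>\<^sup>2 / 16"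
    and \<gamma>1: "\<gamma> \<le> 1 / 16" and T: "(1 - \<gamma>) ^ (2 * T) \<le> \<gamma>"
  defines "X \<equiv> \<lambda>\<omega>. sgd \<eta> \<theta>0 (\<lambda>s. \<mu> + w s \<omega>) T"
  shows "C / 2 \<le> - prob_space.expectation M (\<lambda>\<omega>. cliff_reward \<mu> \<epsilon> C (X \<omega>))"
    and "\<eta> / 8 \<le> prob_space.expectation M (\<lambda>\<omega>. bc_loss \<mu> (X \<omega>))"
    and "prob_space.expectation M (\<lambda>\<omega>. bc_loss \<mu> (X \<omega>)) \<le> \<eta>"
    and "1 / 4 * (\<gamma> / \<eta>) \<le> \<P>(\<omega> in M. - cliff_reward \<mu> \<epsilon> C (X \<omega>) \<le> \<gamma>)"
proof -
  interpret prob_space M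
    using w by (simp add: iid_gaussian_noise_def)
  have w_meas[measurable]: "w s \<in> borel_measurable M" for s
    using w distributed_measurable[of M lborel "w s"] by (auto simp: iid_gaussian_noise_def)
  have X[measurable]: "X \<in> borel_measurable M"
    unfolding X_def by measurable
  \<comment> \<open>1024 is 64 times 16, from chaining the two scale hypotheses.\<close>
  have \<gamma>\<eta>: "1024 * \<gamma> \<le> \<eta>"
    using scale by linarith
  have pow: "(1 - \<eta>) ^ (2 * T) \<le> \<gamma>"
    using power_mono[of "1 - \<eta>" "1 - \<gamma>" "2 * T"] T \<gamma>\<eta> \<gamma> \<eta> by auto
  obtain m \<sigma> where \<sigma>: "0 < \<sigma>"
    and D: "distributed M lborel (\<lambda>\<omega>. X \<omega> - \<mu>) (normal_density m \<sigma>)"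
    and m_eq: "m\<^sup>2 = (1 - \<eta>) ^ (2 * T) * (\<theta>0 - \<mu>)\<^sup>2"
    and lower: "\<eta> / 4 \<le> \<sigma>\<^sup>2" and upper: "\<sigma>\<^sup>2 \<le> \<eta>"
    unfolding X_def
  proof (rule sgd_normal[OF w, where \<eta> = \<eta> and T = T and ?\<theta>0.0 = \<theta>0 and \<mu> = \<mu>])
    show "(1 - \<eta>) ^ (2 * T) \<le> 1 / 16"
      using pow \<gamma>1 by linarith
  qed (use \<eta> in auto)
  have "(\<theta>0 - \<mu>)\<^sup>2 \<le> 1"
    using b abs_le_square_iff[of "\<theta>0 - \<mu>" 1] by simp
  then have m: "m\<^sup>2 \<le> \<gamma>"
    unfolding m_eq using pow \<eta> \<gamma> mult_mono[of "(1 - \<eta>) ^ (2 * T)" \<gamma> "(\<theta>0 - \<mu>)\<^sup>2" 1] by simp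
  have E: "expectation (\<lambda>\<omega>. bc_loss \<mu> (X \<omega>)) = (m\<^sup>2 + \<sigma>\<^sup>2) / 2"
    using normal_second_moment(2)[OF D \<sigma>] by (simp add: bc_loss_def)
  show "\<eta> / 8 \<le> expectation (\<lambda>\<omega>. bc_loss \<mu> (X \<omega>))"
    unfolding E using add_increasing[OF zero_le_power2[of m] lower] by simp
  show "expectation (\<lambda>\<omega>. bc_loss \<mu> (X \<omega>)) \<le> \<eta>"
    unfolding E add_divide_distrib using upper m \<gamma>\<eta> \<gamma> by linarith

  have "(4 * \<epsilon>)\<^sup>2 \<le> 2 * pi * \<sigma>\<^sup>2"
  proof -
    have "1 * \<sigma>\<^sup>2 \<le> (2 * pi) * \<sigma>\<^sup>2"
      using pi_gt3 by (intro mult_right_mono) auto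
    then show ?thesis
      using lower scale by (simp add: power_mult_distrib)
  qed
  then have "4 * \<epsilon> \<le> sqrt (2 * pi * \<sigma>\<^sup>2)"
    by (rule real_le_rsqrt)
  then have "2 * \<epsilon> / sqrt (2 * pi * \<sigma>\<^sup>2) \<le> 1 / 2"
    using \<epsilon> \<sigma> by (simp add: divide_le_eq)
  then have small: "\<P>(\<omega> in M. \<bar>X \<omega> - \<mu>\<bar> \<le> \<epsilon>) \<le> 1 / 2"
    using normal_small_ball_upper[OF D \<sigma>, of \<epsilon>] \<epsilon> by simp
  have "\<P>(\<omega> in M. \<epsilon> < \<bar>X \<omega> - \<mu>\<bar>) = 1 - \<P>(\<omega> in M. \<bar>X \<omega> - \<mu>\<bar> \<le> \<epsilon>)"
    using prob_neg[of "\<lambda>\<omega>. \<bar>X \<omega> - \<mu>\<bar> \<le> \<epsilon>"] by (simp add: not_le)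
  then have "C * (1 / 2) \<le> C * \<P>(\<omega> in M. \<epsilon> < \<bar>X \<omega> - \<mu>\<bar>)"
    using small C by (intro mult_left_mono) auto
  then show "C / 2 \<le> - expectation (\<lambda>\<omega>. cliff_reward \<mu> \<epsilon> C (X \<omega>))"
    using cliff_reward_expectation_le[OF X, of \<mu> \<epsilon> C] by simp

  \<comment> \<open>A density of order \<open>1 / sqrt \<eta>\<close> near the optimum over a ball
    of radius \<open>sqrt \<gamma>\<close> gives mass of order
    \<open>sqrt (\<gamma> / \<eta>)\<close>, which dominates \<open>\<gamma> / \<eta>\<close> as the
    quotient is at most 1.\<close>
  have ratio: "0 \<le> \<gamma> / \<eta>" "\<gamma> / \<eta> \<le> 1"
    using \<gamma> \<gamma>\<eta> \<eta> by auto
  have "\<bar>m\<bar> \<le> sqrt \<gamma>"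
    using m by (simp add: real_le_rsqrt)
  then have "(\<bar>m\<bar> + sqrt \<gamma>)\<^sup>2 \<le> (2 * sqrt \<gamma>)\<^sup>2"
    using \<gamma> by (intro power_mono) auto
  also have "\<dots> = 4 * \<gamma>"
    using \<gamma> by (simp add: power_mult_distrib)
  also have "\<dots> \<le> \<sigma>\<^sup>2"
    using \<gamma>\<eta> \<gamma> lower by linarith
  finally have "(\<bar>m\<bar> + sqrt \<gamma>)\<^sup>2 / (2 * \<sigma>\<^sup>2) \<le> 1 / 2"
    using \<sigma> by (simp add: divide_le_eq)
  \<comment> \<open>The Gaussian factor is at least \<open>exp (- 1/2)\<close>, and
    \<open>1 + x \<le> exp x\<close> bounds this by 1/2.\<close>
  then have half: "1 / 2 \<le> exp (- (\<bar>m\<bar> + sqrt \<gamma>)\<^sup>2 / (2 * \<sigma>\<^sup>2))"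
    using exp_ge_add_one_self[of "- (\<bar>m\<bar> + sqrt \<gamma>)\<^sup>2 / (2 * \<sigma>\<^sup>2)"] by simp
  \<comment> \<open>The bound 8 on \<open>2 * pi\<close> is relaxed to 16, whose root is an
    integer.\<close>
  have "2 * pi * \<sigma>\<^sup>2 \<le> 16 * \<eta>"
    using pi_less_4 upper \<sigma> \<eta> mult_mono[of "2 * pi" 16 "\<sigma>\<^sup>2" \<eta>] by simp
  then have "sqrt (2 * pi * \<sigma>\<^sup>2) \<le> sqrt (16 * \<eta>)"
    by (rule real_sqrt_le_mono)
  also have "\<dots> = 4 * sqrt \<eta>"
    by (simp add: real_sqrt_mult)
  finally have den: "sqrt (2 * pi * \<sigma>\<^sup>2) \<le> 4 * sqrt \<eta>" .
  have "\<gamma> / \<eta> \<le> sqrt (\<gamma> / \<eta>)"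
    using ratio mult_left_mono[OF ratio(2) ratio(1)] by (intro real_le_rsqrt) (simp add: power2_eq_square)
  then have "1 / 4 * (\<gamma> / \<eta>) \<le> 2 * sqrt \<gamma> / (4 * sqrt \<eta>) * (1 / 2)"
    by (simp add: real_sqrt_divide)
  also have "\<dots> \<le> 2 * sqrt \<gamma> / sqrt (2 * pi * \<sigma>\<^sup>2) * exp (- (\<bar>m\<bar> + sqrt \<gamma>)\<^sup>2 / (2 * \<sigma>\<^sup>2))"
    using \<gamma> \<sigma> \<eta> den half by (intro mult_mono divide_left_mono) auto
  also have "\<dots> \<le> \<P>(\<omega> in M. \<bar>X \<omega> - \<mu>\<bar> \<le> sqrt \<gamma>)"
    using normal_small_ball_lower[OF D \<sigma>, of "sqrt \<gamma>"] \<gamma> by simp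
  also have "\<dots> \<le> \<P>(\<omega> in M. - cliff_reward \<mu> \<epsilon> C (X \<omega>) \<le> \<gamma>)"
  proof (rule finite_measure_mono)
    have "- cliff_reward \<mu> \<epsilon> C x \<le> \<gamma>" if x: "\<bar>x - \<mu>\<bar> \<le> sqrt \<gamma>" for x
    proof -
      have "sqrt \<gamma> \<le> \<epsilon>"
        using scale \<epsilon> \<gamma> by (intro real_le_lsqrt) auto
      moreover have "\<bar>x - \<mu>\<bar>\<^sup>2 \<le> (sqrt \<gamma>)\<^sup>2"
        using x by (intro power_mono) auto
      ultimately show ?thesis
        using x \<gamma> by (simp add: cliff_reward_def)
    qed
    then show "{\<omega>\<in>space M. \<bar>X \<omega> - \<mu>\<bar> \<le> sqrt \<gamma>} \<subseteq> {\<omega>\<in>space M. - cliff_reward \<mu> \<epsilon> C (X \<omega>) \<le> \<gamma>}"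
      by auto
  qed (simp add: cliff_reward_def[abs_def])
  finally show "1 / 4 * (\<gamma> / \<eta>) \<le> \<P>(\<omega> in M. - cliff_reward \<mu> \<epsilon> C (X \<omega>) \<le> \<gamma>)" .
qed

text \<open>Squared bias and variance of the average are at most \<open>4 * \<gamma>\<close> each.
  Their sum gives the 8 in front of \<open>\<gamma>\<close>; the 16 in the tail exponent times this
  4 gives 64.\<close>

lemma ema_sgd_cliff_bounds:
  assumes w: "iid_gaussian_noise M 1 w" and \<epsilon>: "0 < \<epsilon>" and C: "0 < C" and \<eta>: "\<eta> \<le> 1"
    and \<gamma>: "0 < \<gamma>" and b: "\<bar>\<theta>0 - \<mu>\<bar> \<le> 1" and scale: "16 * \<gamma> \<le> \<eta>" "\<gamma> \<le> \<epsilon>\<^sup>2 / 16"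
    and T: "(1 - \<gamma>) ^ (2 * T) \<le> \<gamma>"
  defines "Z \<equiv> \<lambda>\<omega>. ema \<gamma> (sgd \<eta> \<theta>0 (\<lambda>s. \<mu> + w s \<omega>)) T"
  shows "- prob_space.expectation M (\<lambda>\<omega>. cliff_reward \<mu> \<epsilon> C (Z \<omega>))
      \<le> 8 * (\<gamma> + C * exp (- (1 / 64) * \<epsilon>\<^sup>2 / \<gamma>))"
    and "\<gamma> / 8 \<le> prob_space.expectation M (\<lambda>\<omega>. bc_loss \<mu> (Z \<omega>))"
    and "prob_space.expectation M (\<lambda>\<omega>. bc_loss \<mu> (Z \<omega>)) \<le> 4 * \<gamma>"
proof -
  interpret prob_space M
    using w by (simp add: iid_gaussian_noise_def)
  have w_meas[measurable]: "w s \<in> borel_measurable M" for s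
    using w distributed_measurable[of M lborel "w s"] by (auto simp: iid_gaussian_noise_def)
  have Z[measurable]: "Z \<in> borel_measurable M"
    using ema_measurable[of "\<lambda>t \<omega>. sgd \<eta> \<theta>0 (\<lambda>s. \<mu> + w s \<omega>) t" M \<gamma> T]
    by (simp add: Z_def sgd_measurable)
  obtain m \<sigma> where \<sigma>: "0 < \<sigma>"
    and D: "distributed M lborel (\<lambda>\<omega>. Z \<omega> - \<mu>) (normal_density m \<sigma>)"
    and m_le: "m\<^sup>2 \<le> 4 * (1 - \<gamma>) ^ (2 * T) * (\<theta>0 - \<mu>)\<^sup>2"
    and lower: "\<gamma> / 4 \<le> \<sigma>\<^sup>2" and upper: "\<sigma>\<^sup>2 \<le> 4 * \<gamma>"
    unfolding Z_def
  proof (rule ema_sgd_normal[OF w, where \<gamma> = \<gamma> and \<eta> = \<eta> and T = T and ?\<theta>0.0 = \<theta>0 and \<mu> = \<mu>])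
    show "(1 - \<gamma>) ^ (2 * T) \<le> 1 / 16"
      using T scale(1) \<eta> by linarith
  qed (use \<gamma> scale \<eta> in auto)
  have "(\<theta>0 - \<mu>)\<^sup>2 \<le> 1"
    using b abs_le_square_iff[of "\<theta>0 - \<mu>" 1] by simp
  then have "4 * (1 - \<gamma>) ^ (2 * T) * (\<theta>0 - \<mu>)\<^sup>2 \<le> 4 * \<gamma> * 1"
    using T \<gamma> by (intro mult_mono) auto
  then have m: "m\<^sup>2 \<le> 4 * \<gamma>"
    using m_le by simp
  have E2: "expectation (\<lambda>\<omega>. (Z \<omega> - \<mu>)\<^sup>2) = m\<^sup>2 + \<sigma>\<^sup>2"
    by (rule normal_second_moment(2)[OF D \<sigma>])
  then have E: "expectation (\<lambda>\<omega>. bc_loss \<mu> (Z \<omega>)) = (m\<^sup>2 + \<sigma>\<^sup>2) / 2"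
    by (simp add: bc_loss_def)
  show "\<gamma> / 8 \<le> expectation (\<lambda>\<omega>. bc_loss \<mu> (Z \<omega>))"
    unfolding E using add_increasing[OF zero_le_power2[of m] lower] by simp
  show "expectation (\<lambda>\<omega>. bc_loss \<mu> (Z \<omega>)) \<le> 4 * \<gamma>"
    unfolding E add_divide_distrib using upper m by linarith

  \<comment> \<open>This is where \<open>\<gamma> \<le> \<epsilon>^2 / 16\<close> enters: the bias
    fits into half of the ball, as the tail bound requires.\<close>
  have "(2 * m)\<^sup>2 \<le> \<epsilon>\<^sup>2"
    using m scale by (simp add: power_mult_distrib)
  then have "2 * \<bar>m\<bar> \<le> \<epsilon>"
    using \<epsilon> abs_le_square_iff[of "2 * m" \<epsilon>] by (simp add: abs_mult)
  then have "\<P>(\<omega> in M. \<epsilon> < \<bar>Z \<omega> - \<mu>\<bar>) \<le> 2 * exp (- \<epsilon>\<^sup>2 / (16 * \<sigma>\<^sup>2))"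
    by (rule normal_tail[OF D \<sigma>])
  also have "\<dots> \<le> 2 * exp (- (1 / 64) * \<epsilon>\<^sup>2 / \<gamma>)"
  proof -
    have "\<epsilon>\<^sup>2 / (64 * \<gamma>) \<le> \<epsilon>\<^sup>2 / (16 * \<sigma>\<^sup>2)"
      using upper \<sigma> \<gamma> by (intro divide_left_mono) auto
    then show ?thesis
      by simp
  qed
  finally have "C * \<P>(\<omega> in M. \<epsilon> < \<bar>Z \<omega> - \<mu>\<bar>) \<le> C * (2 * exp (- (1 / 64) * \<epsilon>\<^sup>2 / \<gamma>))"
    using C by (intro mult_left_mono) auto
  \<comment> \<open>The factor 2 of the tail bound is relaxed to 8 so that one constant serves both
    summands.\<close>
  moreover have "C * (2 * exp (- (1 / 64) * \<epsilon>\<^sup>2 / \<gamma>)) \<le> 8 * (C * exp (- (1 / 64) * \<epsilon>\<^sup>2 / \<gamma>))"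
    using C by simp
  ultimately show "- expectation (\<lambda>\<omega>. cliff_reward \<mu> \<epsilon> C (Z \<omega>))
      \<le> 8 * (\<gamma> + C * exp (- (1 / 64) * \<epsilon>\<^sup>2 / \<gamma>))"
    using cliff_reward_expectation_ge[OF Z normal_second_moment(1)[OF D \<sigma>], of C \<epsilon>] upper m
    unfolding E2 distrib_left by linarith
qed

section \<open>Choice of the universal constants and assembly\<close>

theorem propositionC6:
  "\<exists>c1 c2 c3 c4 c5 c6 c7 c8 c9 :: real.
     c1 > 0 \<and> c2 > 0 \<and> c3 > 0 \<and> c4 > 0 \<and> c5 > 0 \<and> c6 > 0 \<and> c7 > 0 \<and> c8 > 0 \<and> c9 > 0 \<and>
     c1 \<ge> c2 \<and>
     (\<forall>(M :: 'a measure) (w :: nat \<Rightarrow> 'a \<Rightarrow> real)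
        (\<mu> :: real) (\<epsilon> :: real) (C :: real) (\<eta> :: real) (\<gamma> :: real) (T :: nat) (\<theta>0 :: real).
        iid_gaussian_noise M 1 w \<longrightarrow>
        0 < \<epsilon> \<longrightarrow> \<epsilon> \<le> 1 \<longrightarrow> C > 0 \<longrightarrow>
        \<eta> \<in> {0<..1} \<longrightarrow> \<gamma> \<in> {0<..1} \<longrightarrow> T \<ge> 1 \<longrightarrow>
        \<bar>\<theta>0 - \<mu>\<bar> \<le> 1 \<longrightarrow>
        \<eta> \<ge> c1 * \<epsilon>\<^sup>2 \<longrightarrow> c1 * \<epsilon>\<^sup>2 \<ge> c2 * \<epsilon>\<^sup>2 \<longrightarrow> c2 * \<epsilon>\<^sup>2 \<ge> \<gamma> \<longrightarrow>
        (1 - \<gamma>) ^ (2 * T) \<le> \<gamma> \<longrightarrow>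
        (let \<theta> = (\<lambda>t \<omega>. sgd \<eta> \<theta>0 (\<lambda>s. \<mu> + w s \<omega>) t);
             \<theta>ema = (\<lambda>t \<omega>. ema \<gamma> (\<lambda>s. \<theta> s \<omega>) t);
             J = cliff_reward \<mu> \<epsilon> C;
             \<theta>star = \<mu>
         in
           \<comment> \<open>(a)\<close>
           (J \<theta>star - prob_space.expectation M (\<lambda>\<omega>. J (\<theta> T \<omega>)) \<ge> C / 2 \<and>
            J \<theta>star - prob_space.expectation M (\<lambda>\<omega>. J (\<theta>ema T \<omega>))
              \<le> c3 * (\<gamma> + C * exp (- c4 * \<epsilon>\<^sup>2 / \<gamma>))) \<and>
           \<comment> \<open>(b)\<close>
           (c5 * \<eta> \<le> prob_space.expectation M (\<lambda>\<omega>. bc_loss \<mu> (\<theta> T \<omega>)) \<and>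
            prob_space.expectation M (\<lambda>\<omega>. bc_loss \<mu> (\<theta> T \<omega>)) \<le> c6 * \<eta> \<and>
            c5 * \<gamma> \<le> prob_space.expectation M (\<lambda>\<omega>. bc_loss \<mu> (\<theta>ema T \<omega>)) \<and>
            prob_space.expectation M (\<lambda>\<omega>. bc_loss \<mu> (\<theta>ema T \<omega>)) \<le> c6 * \<gamma>) \<and>
           \<comment> \<open>(c)\<close>
           (\<epsilon>\<^sup>2 \<ge> c7 * \<gamma> * ln (C / \<gamma>) \<longrightarrow>
              J \<theta>star - prob_space.expectation M (\<lambda>\<omega>. J (\<theta> T \<omega>)) \<ge> C / 2 \<and>
              J \<theta>star - prob_space.expectation M (\<lambda>\<omega>. J (\<theta>ema T \<omega>)) \<le> c8 * \<gamma>) \<and>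
           \<comment> \<open>(d)\<close>
           (J \<theta>star - prob_space.expectation M (\<lambda>\<omega>. J (\<theta> T \<omega>)) \<ge> C / 2 \<and>
            \<P>(\<omega> in M. J \<theta>star - J (\<theta> T \<omega>) \<le> \<gamma>) \<ge> c9 * (\<gamma> / \<eta>))))"
\<comment> \<open>The first six values and \<open>c9\<close> are those of the two bound lemmas, with
  \<open>c6\<close> the larger of two upper constants. \<open>c7\<close> is the reciprocal of
  \<open>c4\<close>, and \<open>c8\<close> is twice \<open>c3\<close> because in (c) both summands
  are at most \<open>\<gamma>\<close>.\<close>
proof (rule exI[of _ 64], rule exI[of _ "1 / 16"], rule exI[of _ 8], rule exI[of _ "1 / 64"],
    rule exI[of _ "1 / 8"], rule exI[of _ 4], rule exI[of _ 64], rule exI[of _ 16], rule exI[of _ "1 / 4"],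
    intro conjI allI impI)
  fix M :: "'a measure" and w :: "nat \<Rightarrow> 'a \<Rightarrow> real" and \<mu> \<epsilon> C \<eta> \<gamma> :: real and T :: nat and \<theta>0 :: real
  assume w: "iid_gaussian_noise M 1 w" and \<epsilon>: "0 < \<epsilon>" "\<epsilon> \<le> 1" and C: "C > 0"
    and \<eta>: "\<eta> \<in> {0<..1}" and \<gamma>: "\<gamma> \<in> {0<..1}" and b: "\<bar>\<theta>0 - \<mu>\<bar> \<le> 1"
    and scale: "\<eta> \<ge> 64 * \<epsilon>\<^sup>2" "1 / 16 * \<epsilon>\<^sup>2 \<ge> \<gamma>" and T: "(1 - \<gamma>) ^ (2 * T) \<le> \<gamma>"
  have scale': "\<gamma> \<le> \<epsilon>\<^sup>2 / 16" "16 * \<gamma> \<le> \<eta>" "\<gamma> \<le> 1 / 16" "0 < \<gamma>" "\<eta> \<le> 1"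
    using scale \<epsilon> \<eta> \<gamma> power_le_one[of \<epsilon> 2] by auto
  note sgd = sgd_cliff_bounds[OF w \<epsilon>(1) C \<eta> scale'(4) b scale(1) scale'(1,3) T]
  note ema = ema_sgd_cliff_bounds[OF w \<epsilon>(1) C scale'(5,4) b scale'(2,1) T]
  have J0: "cliff_reward \<mu> \<epsilon> C \<mu> = 0"
    using \<epsilon> by (simp add: cliff_reward_def)
  \<comment> \<open>Exponentiating the logarithmic condition bounds the exponential by
    \<open>\<gamma> / C\<close>; the argument holds for either sign of the logarithm.\<close>
  have c: "C * exp (- (1 / 64) * \<epsilon>\<^sup>2 / \<gamma>) \<le> \<gamma>" if "\<epsilon>\<^sup>2 \<ge> 64 * \<gamma> * ln (C / \<gamma>)"
  proof -
    have "ln (C / \<gamma>) \<le> \<epsilon>\<^sup>2 / (64 * \<gamma>)"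
      using that scale'(4) by (simp add: pos_le_divide_eq mult_ac)
    then have "exp (- (1 / 64) * \<epsilon>\<^sup>2 / \<gamma>) \<le> exp (- ln (C / \<gamma>))"
      by simp
    also have "\<dots> = \<gamma> / C"
      using C scale'(4) by (simp add: exp_minus)
    finally show ?thesis
      using C by (simp add: pos_le_divide_eq mult.commute)
  qed
  show "let \<theta> = (\<lambda>t \<omega>. sgd \<eta> \<theta>0 (\<lambda>s. \<mu> + w s \<omega>) t);
            \<theta>ema = (\<lambda>t \<omega>. ema \<gamma> (\<lambda>s. \<theta> s \<omega>) t);
            J = cliff_reward \<mu> \<epsilon> C;
            \<theta>star = \<mu>
        in
          (J \<theta>star - prob_space.expectation M (\<lambda>\<omega>. J (\<theta> T \<omega>)) \<ge> C / 2 \<and>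
           J \<theta>star - prob_space.expectation M (\<lambda>\<omega>. J (\<theta>ema T \<omega>))
             \<le> 8 * (\<gamma> + C * exp (- (1 / 64) * \<epsilon>\<^sup>2 / \<gamma>))) \<and>
          (1 / 8 * \<eta> \<le> prob_space.expectation M (\<lambda>\<omega>. bc_loss \<mu> (\<theta> T \<omega>)) \<and>
           prob_space.expectation M (\<lambda>\<omega>. bc_loss \<mu> (\<theta> T \<omega>)) \<le> 4 * \<eta> \<and>
           1 / 8 * \<gamma> \<le> prob_space.expectation M (\<lambda>\<omega>. bc_loss \<mu> (\<theta>ema T \<omega>)) \<and>
           prob_space.expectation M (\<lambda>\<omega>. bc_loss \<mu> (\<theta>ema T \<omega>)) \<le> 4 * \<gamma>) \<and>
          (\<epsilon>\<^sup>2 \<ge> 64 * \<gamma> * ln (C / \<gamma>) \<longrightarrow>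
             J \<theta>star - prob_space.expectation M (\<lambda>\<omega>. J (\<theta> T \<omega>)) \<ge> C / 2 \<and>
             J \<theta>star - prob_space.expectation M (\<lambda>\<omega>. J (\<theta>ema T \<omega>)) \<le> 16 * \<gamma>) \<and>
          (J \<theta>star - prob_space.expectation M (\<lambda>\<omega>. J (\<theta> T \<omega>)) \<ge> C / 2 \<and>
           \<P>(\<omega> in M. J \<theta>star - J (\<theta> T \<omega>) \<le> \<gamma>) \<ge> 1 / 4 * (\<gamma> / \<eta>))"
    unfolding Let_def J0 diff_0
  proof (intro conjI impI)
    assume "\<epsilon>\<^sup>2 \<ge> 64 * \<gamma> * ln (C / \<gamma>)"
    from c[OF this] ema(1)
    show "- prob_space.expectation M (\<lambda>\<omega>. cliff_reward \<mu> \<epsilon> C (ema \<gamma> (sgd \<eta> \<theta>0 (\<lambda>s. \<mu> + w s \<omega>)) T))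
        \<le> 16 * \<gamma>"
      unfolding distrib_left by linarith
  next
    \<comment> \<open>The SGD loss is at most \<open>\<eta>\<close>; the 4 is shared with the bound
      for the average.\<close>
    show "prob_space.expectation M (\<lambda>\<omega>. bc_loss \<mu> (sgd \<eta> \<theta>0 (\<lambda>s. \<mu> + w s \<omega>) T)) \<le> 4 * \<eta>"
      using sgd(3) \<eta> by simp
  qed (use sgd ema in simp_all)
qed simp_all

end
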